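(* Define $a(n,\ell)$ for $n,\ell\ge1$ by \[\sqrt{\frac{y-1}{y\,e^{2x(1-y)}-1}}=1+\sum_{n,\ell\ge1}a(n,\ell)\frac{x^{n}}{n!}y^{\ell}.\] Then, for all $n,\ell\ge1$, $a(n,\ell)$ is the number of $n$-edge increasing ordered trees with exactly $\ell-1$ bad vertices, where a vertex is bad if and only if it either initiates a sibling descent, or initiates a sibling ascent and has children.
   Context: An $n$-edge increasing ordered tree is a rooted ordered (plane) tree with vertices labeled bijectively by $0,1,\dots,n$ so that each child's label exceeds its parent's; vertices are identified with labels. A vertex $u$ initiates a sibling descent (respectively ascent) if it has a sibling $v$ immediately to its right and $u>v$ (respectively $u<v$). The left-hand side of the displayed formula is the formal power series in $x$ with constant term $1$. *)

theory Defs
  imports "HOL-Computational_Algebra.Formal_Laurent_Series"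
begin

datatype 'a plane_tree = Node (label: 'a) (children: "'a plane_tree list")

primrec labels :: "'a plane_tree \<Rightarrow> 'a list" where
  "labels (Node a ts) = a # concat (map labels ts)"

primrec subtrees :: "'a plane_tree \<Rightarrow> 'a plane_tree set" where
  "subtrees (Node a ts) = insert (Node a ts) (\<Union> (set (map subtrees ts)))"

text \<open>Each vertex of a tree is the root of exactly one member of \<^term>\<open>subtrees t\<close> when
  the labels are distinct, so quantifying over subtrees is quantifying over vertices.\<close>

definition increasing :: "nat plane_tree \<Rightarrow> bool" where
  "increasing t \<longleftrightarrow> (\<forall>s\<in>subtrees t. \<forall>c\<in>set (children s). label s < label c)"

definition increasing_ordered_trees :: "nat \<Rightarrow> nat plane_tree set" where
  "increasing_ordered_trees n =
     {t. distinct (labels t) \<and> set (labels t) = {0..n} \<and> increasing t}"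

definition next_sibling :: "'a plane_tree \<Rightarrow> 'a \<Rightarrow> 'a \<Rightarrow> bool" where
  "next_sibling t u v \<longleftrightarrow>
     (\<exists>s\<in>subtrees t. \<exists>xs ys. map label (children s) = xs @ u # v # ys)"

definition has_children :: "'a plane_tree \<Rightarrow> 'a \<Rightarrow> bool" where
  "has_children t u \<longleftrightarrow> (\<exists>s\<in>subtrees t. label s = u \<and> children s \<noteq> [])"

definition initiates_sibling_descent :: "nat plane_tree \<Rightarrow> nat \<Rightarrow> bool" where
  "initiates_sibling_descent t u \<longleftrightarrow> (\<exists>v. next_sibling t u v \<and> u > v)"

definition initiates_sibling_ascent :: "nat plane_tree \<Rightarrow> nat \<Rightarrow> bool" where
  "initiates_sibling_ascent t u \<longleftrightarrow> (\<exists>v. next_sibling t u v \<and> u < v)"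

definition bad_vertex :: "nat plane_tree \<Rightarrow> nat \<Rightarrow> bool" where
  "bad_vertex t u \<longleftrightarrow>
     initiates_sibling_descent t u \<or> (initiates_sibling_ascent t u \<and> has_children t u)"

definition bad_vertices :: "nat plane_tree \<Rightarrow> nat set" where
  "bad_vertices t = {u \<in> set (labels t). bad_vertex t u}"

text \<open>Power series in \<open>x\<close> have coefficients in the field of formal Laurent series in \<open>y\<close>,
  which contains both the rational functions in \<open>y\<close>, where the closed form lives, and the
  power series in \<open>y\<close>, where the double sum lives. Here \<open>x\<close> is \<^const>\<open>fps_X\<close>,
  \<open>y\<close> is \<^const>\<open>fls_X\<close>, and \<^term>\<open>fps_exp c\<close> is \<open>exp (c x)\<close>.
  The radicand has constant term 1, and the first argument of \<^const>\<open>fps_radical\<close>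
  picks the square root with constant term 1.\<close>

definition closed_form :: "rat fls fps" where
  "closed_form =
     fps_radical (\<lambda>_ _. 1) 2
       ((fps_const fls_X - 1) / (fps_const fls_X * fps_exp (2 * (1 - fls_X)) - 1))"

text \<open>The double series of \<open>a n l * (x ^ n / n!) * y ^ l\<close> over \<open>n, l \<ge> 1\<close>.\<close>

definition double_series :: "(nat \<Rightarrow> nat \<Rightarrow> rat) \<Rightarrow> rat fls fps" where
  "double_series a =
     Abs_fps (\<lambda>n. if n = 0 then 0
       else fps_to_fls (Abs_fps (\<lambda>l. if l = 0 then 0 else a n l / fact n)))"

end

theory Submission
  imports Defs
begin

text \<open>
  Let \<open>P\<^sub>n(y)\<close> be the sum of \<open>y ^ (b + 1)\<close> over the trees with \<open>n\<close> edges, where \<open>b\<close> is the number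
  of bad vertices. Both sides of the claim come down to the recurrence
  \<open>P\<^sub>n\<^sub>+\<^sub>1 = (2n + 1) y P\<^sub>n + 2y(1 - y) P\<^sub>n'\<close> with \<open>P\<^sub>1 = y\<close>.

  On the combinatorial side, the vertex with the largest label is a leaf, so a tree with \<open>n + 1\<close>
  edges arises exactly once by adding a leaf to a tree with \<open>n\<close> edges, which can be done in
  \<open>2n + 1\<close> places (\<open>increasing_forests_Suc\<close>). Suppose \<open>n \<ge> 1\<close>. The new leaf has the largest label,
  so it is bad unless it is a last sibling, and its left neighbour becomes an ascent. Going through
  the possible places, one sees that the number of bad vertices stays the same precisely if the new
  leaf is put below, or immediately to the right of, an old leaf that initiates a descent or is a
  last sibling; otherwise it grows by one. Every vertex with children has one last child, so there
  are as many last siblings as vertices with children (the root included); hence the number of these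
  old leaves is one more than the number of descents plus the number of ascents with children,
  that is, \<open>b + 1\<close>. So \<open>2(b + 1)\<close> places preserve \<open>b\<close> and the other \<open>2n + 1 - 2(b + 1)\<close> raise it,
  which is the recurrence (\<open>sum_leaf_insertions\<close> establishes this count by recursion over the tree).

  On the analytic side, write \<open>F\<close> for the closed form and \<open>E = y exp (2x(1 - y))\<close>, so that
  \<open>F\<^sup>2 (E - 1) = y - 1\<close>. Since \<open>E\<close> satisfies simple first order equations in \<open>x\<close> and in \<open>y\<close>,
  differentiating in both variables yields
  \<open>(1 - 2xy) F\<^sub>x = y F + 2y(1 - y) F\<^sub>y\<close> (\<open>closed_form_pde\<close>), and the coefficient of
  \<open>x ^ n / n!\<close> in this equation is the same recurrence.

  The root always has label \<open>0\<close> and is never bad, so the proofs work with forests, the list of the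
  subtrees below the root. Forests have a binary recursion: the first root, the
  forest of its children, and the forest of its later siblings.
\<close>

section \<open>Inserting and deleting a leaf\<close>

text \<open>The ways to add a leaf \<open>m\<close> to a forest, other than as its first root. These
  keep the first root in place, so whether a vertex to the left of the forest initiates a descent
  or an ascent does not change.\<close>
fun inner_insertions :: "'a \<Rightarrow> 'a plane_tree list \<Rightarrow> 'a plane_tree list list" where
  "inner_insertions m [] = []"
| "inner_insertions m (Node a us # ts) =
     map (Cons (Node a us)) ((Node m [] # ts) # inner_insertions m ts) @
     map (\<lambda>us'. Node a us' # ts) ((Node m [] # us) # inner_insertions m us)"

definition leaf_insertions :: "'a \<Rightarrow> 'a plane_tree list \<Rightarrow> 'a plane_tree list list" where
  "leaf_insertions m f = (Node m [] # f) # inner_insertions m f"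

text \<open>A vertex below \<open>m\<close> would be lost as well; where this function matters, \<open>m\<close> is fresh or a leaf.\<close>
fun delete_leaf :: "'a \<Rightarrow> 'a plane_tree list \<Rightarrow> 'a plane_tree list" where
  "delete_leaf m [] = []"
| "delete_leaf m (Node a us # ts) =
     (if a = m then ts else Node a (delete_leaf m us) # delete_leaf m ts)"

abbreviation forest_labels :: "'a plane_tree list \<Rightarrow> 'a list" where
  "forest_labels f \<equiv> concat (map labels f)"

text \<open>The number of bad vertices by recursion. The test leaves out the comparison \<open>a < label (hd ts)\<close>
  in the second alternative, because distinct labels make it the only remaining case.\<close>
fun forest_bad :: "nat plane_tree list \<Rightarrow> nat" where
  "forest_bad [] = 0"
| "forest_bad (Node a us # ts) =
     (if ts \<noteq> [] \<and> (label (hd ts) < a \<or> us \<noteq> []) then 1 else 0) + forest_bad us + forest_bad ts"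

lemma delete_leaf_fresh: "m \<notin> set (forest_labels f) \<Longrightarrow> delete_leaf m f = f"
  by (induction m f rule: delete_leaf.induct) auto

lemma delete_inner_insertion:
  "m \<notin> set (forest_labels f) \<Longrightarrow> g \<in> set (inner_insertions m f) \<Longrightarrow> delete_leaf m g = f"
  by (induction m f arbitrary: g rule: inner_insertions.induct) (auto simp: delete_leaf_fresh)

lemma delete_leaf_insertion:
  "m \<notin> set (forest_labels f) \<Longrightarrow> g \<in> set (leaf_insertions m f) \<Longrightarrow> delete_leaf m g = f"
  by (auto simp: leaf_insertions_def delete_inner_insertion)

lemma mset_inner_insertion:
  "g \<in> set (inner_insertions m f) \<Longrightarrow> mset (forest_labels g) = add_mset m (mset (forest_labels f))"
  by (induction m f arbitrary: g rule: inner_insertions.induct) auto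

lemma inner_insertion_head:
  "g \<in> set (inner_insertions m f) \<Longrightarrow> g \<noteq> [] \<and> label (hd g) = label (hd f)"
  by (induction m f rule: inner_insertions.induct) auto

text \<open>An inner insertion keeps the first root, whereas the front insertion makes it \<open>m\<close>.\<close>
lemma front_insertion_not_inner:
  assumes "m \<notin> set (forest_labels f)"
  shows "Node m [] # f \<notin> set (inner_insertions m f)"
proof (cases f)
  case (Cons t f')
  have "label t \<in> set (forest_labels f)" unfolding Cons by (cases t) simp
  thus ?thesis
    using inner_insertion_head[of "Node m [] # f" m f] assms Cons by auto
qed simp

lemma distinct_inner_insertions:
  "m \<notin> set (forest_labels f) \<Longrightarrow> distinct (inner_insertions m f)"
proof (induction m f rule: inner_insertions.induct)
  case (2 m a us ts)
  have "h \<noteq> f" if "h \<in> set (inner_insertions m f)" for f h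
    using mset_inner_insertion[OF that] by auto
  then show ?case using 2 front_insertion_not_inner[of m ts] front_insertion_not_inner[of m us]
    by (auto simp: distinct_map inj_on_def)
qed auto

lemma distinct_leaf_insertions:
  assumes "m \<notin> set (forest_labels f)"
  shows "distinct (leaf_insertions m f)"
  using distinct_inner_insertions[OF assms] front_insertion_not_inner[OF assms]
  by (simp add: leaf_insertions_def)

text \<open>With \<open>b\<close> bad vertices and \<open>k\<close> vertices in all, \<open>2b + 2\<close> of the \<open>2k\<close> inner insertions preserve
  \<open>b\<close> and the others raise it by one; the generating polynomial in \<open>y\<close> records both at once. Inner
  insertions into the forests \<open>us\<close> and \<open>ts\<close> do not affect the first root \<open>a\<close>, so they are covered by
  the induction hypotheses. The two insertions left put the leaf in front of \<open>us\<close> or in front of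
  \<open>ts\<close>. In either case the leaf is bad exactly if the forest that it precedes is not empty, and \<open>a\<close>
  is bad exactly if the other forest is not empty.\<close>
lemma sum_inner_insertions:
  fixes y :: "'a :: comm_ring_1"
  assumes "\<forall>l\<in>set (forest_labels f). l < m" and "f \<noteq> []"
  shows "(\<Sum>g\<leftarrow>inner_insertions m f. y ^ forest_bad g) =
    y ^ forest_bad f * (of_nat (2 * forest_bad f + 2) +
       (of_nat (2 * length (forest_labels f)) - of_nat (2 * forest_bad f + 2)) * y)"
  using assms
proof (induction m f rule: inner_insertions.induct)
  case (2 m a us ts)
  \<comment> \<open>\<open>d\<close> is the contribution of the root \<open>a\<close> itself.\<close>
  define d where "d = (if ts \<noteq> [] \<and> (label (hd ts) < a \<or> us \<noteq> []) then 1 else 0 :: nat)"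
  define S where "S = (\<lambda>f. \<Sum>g\<leftarrow>inner_insertions m f. y ^ forest_bad g)"
  have S_Nil: "S [] = 0" by (simp add: S_def)
  have bad: "forest_bad (Node a us # ts) = d + forest_bad us + forest_bad ts"
    by (simp add: d_def)
  have am: "a < m" using 2 by simp
  have hts: "label (hd ts) < m" if "ts \<noteq> []"
    using that 2(3) by (cases ts; cases "hd ts") auto
  have hus: "label (hd us) < m" if "us \<noteq> []"
    using that 2(3) by (cases us; cases "hd us") auto
  have ts: "(\<Sum>g\<leftarrow>inner_insertions m ts. y ^ forest_bad (Node a us # g)) = y ^ (d + forest_bad us) * S ts"
  proof (cases "ts = []")
    case False
    have "(\<Sum>g\<leftarrow>inner_insertions m ts. y ^ forest_bad (Node a us # g)) =
      (\<Sum>g\<leftarrow>inner_insertions m ts. y ^ (d + forest_bad us) * y ^ forest_bad g)"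
      using False inner_insertion_head[of _ m ts]
      by (intro arg_cong[of _ _ sum_list] map_cong) (auto simp: power_add d_def)
    thus ?thesis by (simp only: sum_list_const_mult S_def)
  qed (simp add: S_Nil)
  have us: "(\<Sum>g\<leftarrow>inner_insertions m us. y ^ forest_bad (Node a g # ts)) = y ^ (d + forest_bad ts) * S us"
  proof (cases "us = []")
    case False
    have "(\<Sum>g\<leftarrow>inner_insertions m us. y ^ forest_bad (Node a g # ts)) =
      (\<Sum>g\<leftarrow>inner_insertions m us. y ^ (d + forest_bad ts) * y ^ forest_bad g)"
      using False inner_insertion_head[of _ m us]
      by (intro arg_cong[of _ _ sum_list] map_cong) (auto simp: power_add d_def)
    thus ?thesis by (simp only: sum_list_const_mult S_def)
  qed (simp add: S_Nil)
  \<comment> \<open>Both front insertions lead to the same number of bad vertices.\<close>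
  have front: "forest_bad (Node a us # Node m [] # ts) =
      of_bool (us \<noteq> []) + of_bool (ts \<noteq> []) + forest_bad us + forest_bad ts"
    "forest_bad (Node a (Node m [] # us) # ts) =
      of_bool (us \<noteq> []) + of_bool (ts \<noteq> []) + forest_bad us + forest_bad ts"
    using am hts hus by auto
  have total: "(\<Sum>g\<leftarrow>inner_insertions m (Node a us # ts). y ^ forest_bad g) =
     2 * y ^ (of_bool (us \<noteq> []) + of_bool (ts \<noteq> []) + forest_bad us + forest_bad ts) +
     y ^ d * (y ^ forest_bad us * S ts + y ^ forest_bad ts * S us)"
    unfolding inner_insertions.simps map_append sum_list_append list.map map_map o_def
      sum_list.Cons front ts us
    by (simp add: power_add algebra_simps)
  have S_ts: "S ts = y ^ forest_bad ts * (of_nat (2 * forest_bad ts + 2) +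
       (of_nat (2 * length (forest_labels ts)) - of_nat (2 * forest_bad ts + 2)) * y)" if "ts \<noteq> []"
    using 2 that by (simp add: S_def)
  have S_us: "S us = y ^ forest_bad us * (of_nat (2 * forest_bad us + 2) +
       (of_nat (2 * length (forest_labels us)) - of_nat (2 * forest_bad us + 2)) * y)" if "us \<noteq> []"
    using 2 that by (simp add: S_def)
  consider "ts = []" "us = []" | "ts = []" "us \<noteq> []" | "ts \<noteq> []" "us = []" "d = 0"
    | "ts \<noteq> []" "us = []" "d = 1" | "ts \<noteq> []" "us \<noteq> []" "d = 1"
    by (cases "ts = []"; cases "us = []"; cases "label (hd ts) < a") (simp_all add: d_def)
  thus ?case
  proof cases
    case 1
    thus ?thesis unfolding total bad by (simp add: S_Nil d_def algebra_simps)
  next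
    case 2
    thus ?thesis unfolding total bad by (simp add: S_Nil S_us d_def algebra_simps power_add)
  next
    case 3
    thus ?thesis unfolding total bad by (simp add: S_Nil S_ts algebra_simps power_add)
  next
    case 4
    thus ?thesis unfolding total bad by (simp add: S_Nil S_ts algebra_simps power_add)
  next
    case 5
    thus ?thesis unfolding total bad by (simp add: S_us S_ts algebra_simps power_add)
  qed
qed simp

text \<open>The additional insertion at the front always raises the number of bad vertices,
  as the new leaf initiates a descent.\<close>
lemma sum_leaf_insertions:
  fixes y :: "'a :: comm_ring_1"
  assumes "\<forall>l\<in>set (forest_labels f). l < m" and "f \<noteq> []"
  shows "(\<Sum>g\<leftarrow>leaf_insertions m f. y ^ forest_bad g) =
    y ^ forest_bad f * (of_nat (2 * forest_bad f + 2) +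
       (of_nat (2 * length (forest_labels f)) - of_nat (2 * forest_bad f + 1)) * y)"
proof -
  have "label (hd f) < m"
    using assms by (cases f; cases "hd f") auto
  hence "forest_bad (Node m [] # f) = Suc (forest_bad f)"
    using assms by simp
  thus ?thesis
    by (simp add: leaf_insertions_def sum_inner_insertions[OF assms] algebra_simps)
qed

section \<open>Increasing forests grow by their largest label\<close>

lemma increasing_Node:
  "increasing (Node a us) \<longleftrightarrow> (\<forall>c\<in>set us. a < label c) \<and> (\<forall>c\<in>set us. increasing c)"
  by (auto simp: increasing_def)

lemma label_in_labels: "label t \<in> set (labels t)"
  by (cases t) simp

lemma increasing_root_le: "increasing t \<Longrightarrow> l \<in> set (labels t) \<Longrightarrow> label t \<le> l"
proof (induction t)
  case (Node a us)
  thus ?case by (fastforce simp: increasing_Node)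
qed

text \<open>The forests that remain when the root \<open>0\<close> of an increasing ordered tree is removed.\<close>
definition increasing_forests :: "nat \<Rightarrow> nat plane_tree list set" where
  "increasing_forests n =
     {f. distinct (forest_labels f) \<and> set (forest_labels f) = {1..n} \<and> (\<forall>t\<in>set f. increasing t)}"

lemma increasing_ordered_trees_eq:
  "increasing_ordered_trees n = Node 0 ` increasing_forests n"
proof (rule set_eqI)
  fix t :: "nat plane_tree"
  obtain a us where t: "t = Node a us" by (cases t)
  have a: "a = 0" if "t \<in> increasing_ordered_trees n"
    using that increasing_root_le[of t 0] by (simp add: increasing_ordered_trees_def t)
  have lab: "label c \<in> set (forest_labels us)" if "c \<in> set us" for c
    using that label_in_labels[of c] by auto
  have ins: "insert 0 A = {0..n} \<longleftrightarrow> A = {1..n}" if "0 \<notin> A" for A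
  proof -
    have "{0..n} = insert 0 {1..n}" by auto
    thus ?thesis using that by (metis atLeastAtMost_iff insert_ident not_one_le_zero)
  qed
  show "t \<in> increasing_ordered_trees n \<longleftrightarrow> t \<in> Node 0 ` increasing_forests n"
  proof (cases "a = 0")
    case True
    have "t \<in> increasing_ordered_trees n \<longleftrightarrow> 0 \<notin> set (forest_labels us) \<and> distinct (forest_labels us) \<and>
       insert 0 (set (forest_labels us)) = {0..n} \<and> (\<forall>c\<in>set us. 0 < label c) \<and> (\<forall>c\<in>set us. increasing c)"
      by (simp add: increasing_ordered_trees_def t True increasing_Node)
    also have "\<dots> \<longleftrightarrow> 0 \<notin> set (forest_labels us) \<and> distinct (forest_labels us) \<and>
       set (forest_labels us) = {1..n} \<and> (\<forall>c\<in>set us. increasing c)"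
      using lab ins[of "set (forest_labels us)"] by (metis gr0I)
    also have "\<dots> \<longleftrightarrow> us \<in> increasing_forests n"
    proof -
      have "0 \<notin> set (forest_labels us)" if "set (forest_labels us) = {1..n}"
        unfolding that by simp
      thus ?thesis unfolding increasing_forests_def by blast
    qed
    finally show ?thesis by (auto simp: t True)
  qed (use a t in auto)
qed

lemma roots_inner_insertion:
  assumes "g \<in> set (inner_insertions m f)"
  shows "label ` set g \<subseteq> insert m (label ` set f)"
  using assms
proof (induction m f arbitrary: g rule: inner_insertions.induct)
  case (2 m a us ts)
  from "2.prems" consider "g = Node a us # Node m [] # ts"
    | h where "h \<in> set (inner_insertions m ts)" "g = Node a us # h"
    | us' where "g = Node a us' # ts"
    by auto
  thus ?case
  proof cases
    case (2 h)
    from "2.IH"(1)[OF 2(1)] show ?thesis unfolding 2(2) by auto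
  qed auto
qed simp

lemma increasing_inner_insertion:
  "\<forall>l\<in>set (forest_labels f). l < m \<Longrightarrow> \<forall>t\<in>set f. increasing t \<Longrightarrow>
   g \<in> set (inner_insertions m f) \<Longrightarrow> \<forall>t\<in>set g. increasing t"
proof (induction m f arbitrary: g rule: inner_insertions.induct)
  case (2 m a us ts)
  have *: "\<forall>c\<in>set h. a < label c" if "h \<in> set (inner_insertions m us)" for h
    using roots_inner_insertion[OF that] 2(3,4) by (fastforce simp: increasing_Node)
  have leaf: "increasing (Node m [])" by (simp add: increasing_Node)
  have us: "\<forall>c\<in>set us. a < label c \<and> increasing c" "a < m" and ts: "\<forall>c\<in>set ts. increasing c"
    using 2(3,4) by (simp_all add: increasing_Node)
  have "\<forall>t\<in>set h. increasing t" if "h \<in> set (inner_insertions m ts)" for h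
    by (rule "2.IH"(1)) (use "2.prems" that in simp_all)
  moreover have "\<forall>t\<in>set h. increasing t" if "h \<in> set (inner_insertions m us)" for h
    by (rule "2.IH"(2)) (use "2.prems" us that in simp_all)
  ultimately show ?case using "2.prems"(3) us ts leaf *
    unfolding inner_insertions.simps set_append set_map list.set(2) image_insert
    by (elim UnE insertE imageE) (simp_all add: increasing_Node)
qed simp

lemma increasing_leaf_insertion:
  assumes "\<forall>l\<in>set (forest_labels f). l < m" "\<forall>t\<in>set f. increasing t"
    and "g \<in> set (leaf_insertions m f)"
  shows "\<forall>t\<in>set g. increasing t"
proof (cases "g = Node m [] # f")
  case True
  thus ?thesis using assms(2) by (simp add: increasing_Node)
next
  case False
  with assms(3) have "g \<in> set (inner_insertions m f)" by (simp add: leaf_insertions_def)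
  with assms(1,2) show ?thesis by (rule increasing_inner_insertion)
qed

lemma roots_delete_leaf:
  "label ` set (delete_leaf m g) \<subseteq> label ` set g"
  by (induction m g rule: delete_leaf.induct) auto

lemma insertion_among_children:
  "us \<in> set (leaf_insertions m us') \<Longrightarrow> Node a us # ts \<in> set (leaf_insertions m (Node a us' # ts))"
  by (auto simp: leaf_insertions_def)

lemma insertion_among_later_siblings:
  "ts \<in> set (leaf_insertions m ts') \<Longrightarrow> Node a us # ts \<in> set (leaf_insertions m (Node a us # ts'))"
  by (auto simp: leaf_insertions_def)

text \<open>In an increasing forest nothing can lie below the largest label \<open>m\<close>, so deleting it removes a
  single leaf, and reinserting that leaf recovers the forest.\<close>
lemma insertion_delete_leaf:
  assumes "distinct (forest_labels g)" "m \<in> set (forest_labels g)"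
    "\<forall>l\<in>set (forest_labels g). l \<le> m" "\<forall>t\<in>set g. increasing t"
  shows "g \<in> set (leaf_insertions m (delete_leaf m g)) \<and> (\<forall>t\<in>set (delete_leaf m g). increasing t)"
  using assms
proof (induction m g rule: delete_leaf.induct)
  case (2 m a us ts)
  have a: "a < label c" if "c \<in> set us" for c
    using that 2(6) by (simp add: increasing_Node)
  have m: "label c \<le> m" if "c \<in> set us" for c
    using that 2(5) label_in_labels[of c] by auto
  consider "a = m" | "a \<noteq> m" "m \<in> set (forest_labels us)" | "a \<noteq> m" "m \<in> set (forest_labels ts)"
    using 2(4) by auto
  thus ?case
  proof cases
    case 1
    hence "us = []" using a m by (cases us) fastforce+
    thus ?thesis using 1 2(6) by (simp add: leaf_insertions_def)
  next
    case 2
    hence "m \<notin> set (forest_labels ts)" using "2.prems"(1) by auto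
    moreover have "us \<in> set (leaf_insertions m (delete_leaf m us)) \<and> (\<forall>t\<in>set (delete_leaf m us). increasing t)"
      using 2 "2.prems" by (intro "2.IH") (auto simp: increasing_Node)
    moreover have "\<forall>c\<in>set (delete_leaf m us). a < label c"
    proof
      fix c assume "c \<in> set (delete_leaf m us)"
      hence "label c \<in> label ` set us" using roots_delete_leaf[of m us] by blast
      thus "a < label c" using a by auto
    qed
    moreover have "delete_leaf m (Node a us # ts) = Node a (delete_leaf m us) # ts"
      using 2(1) delete_leaf_fresh[OF \<open>m \<notin> set (forest_labels ts)\<close>] by simp
    moreover have "\<forall>t\<in>set ts. increasing t" using "2.prems"(4) by simp
    ultimately show ?thesis by (simp add: insertion_among_children increasing_Node)
  next
    case 3
    hence "m \<notin> set (forest_labels us)" using "2.prems"(1) by auto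
    moreover have "ts \<in> set (leaf_insertions m (delete_leaf m ts)) \<and> (\<forall>t\<in>set (delete_leaf m ts). increasing t)"
      using 3 "2.prems" by (intro "2.IH") (auto simp: increasing_Node)
    moreover have "delete_leaf m (Node a us # ts) = Node a us # delete_leaf m ts"
      using 3(1) delete_leaf_fresh[OF \<open>m \<notin> set (forest_labels us)\<close>] by simp
    moreover have "increasing (Node a us)" using "2.prems"(4) by simp
    ultimately show ?thesis by (simp add: insertion_among_later_siblings)
  qed
qed simp

lemma mset_leaf_insertion:
  "g \<in> set (leaf_insertions m f) \<Longrightarrow> mset (forest_labels g) = add_mset m (mset (forest_labels f))"
  by (auto simp: leaf_insertions_def mset_inner_insertion)

lemma increasing_forests_Suc:
  "increasing_forests (Suc n) = (\<Union>f\<in>increasing_forests n. set (leaf_insertions (Suc n) f))"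
proof (intro equalityI subsetI)
  fix g assume g: "g \<in> increasing_forests (Suc n)"
  define f where "f = delete_leaf (Suc n) g"
  have f: "g \<in> set (leaf_insertions (Suc n) f)" "\<forall>t\<in>set f. increasing t"
  proof -
    have s: "set (forest_labels g) = {1..Suc n}" using g by (simp add: increasing_forests_def)
    have "Suc n \<in> set (forest_labels g)" "\<forall>l\<in>set (forest_labels g). l \<le> Suc n"
      unfolding s by simp_all
    thus "g \<in> set (leaf_insertions (Suc n) f)" "\<forall>t\<in>set f. increasing t"
      using insertion_delete_leaf[of g "Suc n"] g by (simp_all add: increasing_forests_def f_def)
  qed
  note mset = mset_leaf_insertion[OF f(1)]
  have d: "distinct (Suc n # forest_labels f)"
    using g mset_eq_imp_distinct_iff[of "forest_labels g" "Suc n # forest_labels f"] mset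
    by (simp add: increasing_forests_def)
  have "set (forest_labels g) = insert (Suc n) (set (forest_labels f))"
    using mset by (metis set_mset_add_mset_insert set_mset_mset)
  hence "insert (Suc n) (set (forest_labels f)) = {1..Suc n}"
    using g by (simp add: increasing_forests_def)
  moreover have "{1..Suc n} = insert (Suc n) {1..n}" by auto
  ultimately have "set (forest_labels f) = {1..n}"
    using d by (metis atLeastAtMost_iff distinct.simps(2) insert_ident not_less_eq_eq order_refl)
  with d f show "g \<in> (\<Union>f\<in>increasing_forests n. set (leaf_insertions (Suc n) f))"
    by (auto simp: increasing_forests_def)
next
  fix g assume "g \<in> (\<Union>f\<in>increasing_forests n. set (leaf_insertions (Suc n) f))"
  then obtain f where f: "f \<in> increasing_forests n" "g \<in> set (leaf_insertions (Suc n) f)" by auto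
  note mset = mset_leaf_insertion[OF f(2)]
  have s: "set (forest_labels f) = {1..n}" and d: "distinct (forest_labels f)" and i: "\<forall>t\<in>set f. increasing t"
    using f(1) by (auto simp: increasing_forests_def)
  have "distinct (Suc n # forest_labels f)" using s d by simp
  hence "distinct (forest_labels g)"
    using mset_eq_imp_distinct_iff[of "forest_labels g" "Suc n # forest_labels f"] mset by simp
  moreover have "set (forest_labels g) = {1..Suc n}"
    using mset s by (metis set_mset_add_mset_insert set_mset_mset atLeastAtMostSuc_conv le_add1 plus_1_eq_Suc)
  moreover have "\<forall>t\<in>set g. increasing t"
  proof (rule increasing_leaf_insertion[OF _ i f(2)])
    show "\<forall>l\<in>set (forest_labels f). l < Suc n" unfolding s by auto
  qed
  ultimately show "g \<in> increasing_forests (Suc n)" by (simp add: increasing_forests_def)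
qed

lemma increasing_forests_0: "increasing_forests 0 = {[]}"
proof -
  have "f = []" if "f \<in> increasing_forests 0" for f
    using that label_in_labels[of "hd f"] by (cases f) (auto simp: increasing_forests_def)
  thus ?thesis by (auto simp: increasing_forests_def)
qed

lemma finite_increasing_forests: "finite (increasing_forests n)"
  by (induction n) (simp_all add: increasing_forests_0 increasing_forests_Suc)

text \<open>No forest is counted twice: deleting the leaf \<open>Suc n\<close> recovers the smaller forest, and the
  insertions into one forest are pairwise different.\<close>
lemma sum_increasing_forests_Suc:
  "(\<Sum>g\<in>increasing_forests (Suc n). h g) =
     (\<Sum>f\<in>increasing_forests n. \<Sum>g\<leftarrow>leaf_insertions (Suc n) f. h g)"
proof -
  have fresh: "Suc n \<notin> set (forest_labels f)" if "f \<in> increasing_forests n" for f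
    using that by (auto simp: increasing_forests_def)
  have "(\<Sum>g\<in>increasing_forests (Suc n). h g) =
     (\<Sum>f\<in>increasing_forests n. \<Sum>g\<in>set (leaf_insertions (Suc n) f). h g)"
    unfolding increasing_forests_Suc
  proof (rule sum.UNION_disjoint)
    show "\<forall>f\<in>increasing_forests n. \<forall>f'\<in>increasing_forests n. f \<noteq> f' \<longrightarrow>
       set (leaf_insertions (Suc n) f) \<inter> set (leaf_insertions (Suc n) f') = {}"
      using delete_leaf_insertion[OF fresh] by blast
  qed (simp_all add: finite_increasing_forests)
  also have "\<dots> = (\<Sum>f\<in>increasing_forests n. \<Sum>g\<leftarrow>leaf_insertions (Suc n) f. h g)"
    by (intro sum.cong refl sum.distinct_set_conv_list distinct_leaf_insertions fresh)
  finally show ?thesis .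
qed

section \<open>Bad vertices of a forest\<close>

lemma next_sibling_Node:
  "next_sibling (Node a us) u v \<longleftrightarrow>
     (\<exists>xs ys. map label us = xs @ u # v # ys) \<or> (\<exists>c\<in>set us. next_sibling c u v)"
  by (auto simp: next_sibling_def)

lemma has_children_Node:
  "has_children (Node a us) u \<longleftrightarrow> (u = a \<and> us \<noteq> []) \<or> (\<exists>c\<in>set us. has_children c u)"
  by (auto simp: has_children_def)

lemma labels_subtree: "s \<in> subtrees t \<Longrightarrow> set (labels s) \<subseteq> set (labels t)"
  by (induction t) auto

lemma has_children_in_labels: "has_children t u \<Longrightarrow> u \<in> set (labels t)"
  unfolding has_children_def using labels_subtree label_in_labels by blast

lemma labels_children: "set (map label (children t)) \<subseteq> set (labels t)"
  using label_in_labels by (cases t) fastforce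

lemma next_sibling_in_labels:
  assumes "next_sibling (Node a us) u v"
  shows "u \<in> set (forest_labels us)"
proof -
  have *: "u \<in> set (labels t)" if "next_sibling t u v" for t
  proof -
    from that obtain s xs ys where s: "s \<in> subtrees t" "map label (children s) = xs @ u # v # ys"
      unfolding next_sibling_def by blast
    hence "u \<in> set (map label (children s))" by simp
    thus ?thesis using labels_children[of s] labels_subtree[OF s(1)] by blast
  qed
  from assms consider xs ys where "map label us = xs @ u # v # ys" | c where "c \<in> set us" "next_sibling c u v"
    unfolding next_sibling_Node by blast
  thus ?thesis
  proof cases
    case 1
    hence "u \<in> set (map label us)" by simp
    thus ?thesis using label_in_labels by fastforce
  qed (use * in auto)
qed

lemma next_sibling_Cons:
  "next_sibling (Node r (Node a us # ts)) u v \<longleftrightarrow>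
     (u = a \<and> ts \<noteq> [] \<and> v = label (hd ts)) \<or> next_sibling (Node r us) u v \<or> next_sibling (Node r ts) u v"
proof -
  have *: "(\<exists>xs ys. a # map label ts = xs @ u # v # ys) \<longleftrightarrow>
     (u = a \<and> ts \<noteq> [] \<and> v = label (hd ts)) \<or> (\<exists>xs ys. map label ts = xs @ u # v # ys)"
    (is "?L \<longleftrightarrow> ?R")
  proof
    assume ?L
    then obtain xs ys where "a # map label ts = xs @ u # v # ys" by blast
    thus ?R by (cases xs; cases ts) auto
  next
    assume ?R
    thus ?L
    proof (elim disjE conjE exE)
      assume "u = a" "ts \<noteq> []" "v = label (hd ts)"
      hence "a # map label ts = [] @ u # v # map label (tl ts)" by (cases ts) auto
      thus ?L by blast
    next
      fix xs ys assume "map label ts = xs @ u # v # ys"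
      hence "a # map label ts = (a # xs) @ u # v # ys" by simp
      thus ?L by blast
    qed
  qed
  show ?thesis
    by (simp only: next_sibling_Node[of r] list.map plane_tree.sel list.set bex_simps next_sibling_Node[of a us] *) blast
qed

text \<open>The root label \<open>0\<close> serves only to turn the forest into a tree; sibling relations
  do not depend on it.\<close>
definition forest_bad_vertices :: "nat plane_tree list \<Rightarrow> nat set" where
  "forest_bad_vertices f =
     {u. \<exists>v. next_sibling (Node 0 f) u v \<and> (v < u \<or> u < v \<and> (\<exists>c\<in>set f. has_children c u))}"

lemma bad_vertices_Node:
  assumes "0 \<notin> set (forest_labels f)"
  shows "bad_vertices (Node 0 f) = forest_bad_vertices f"
proof -
  have "u \<noteq> 0 \<and> u \<in> set (labels (Node 0 f))" if "next_sibling (Node 0 f) u v" for u v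
    using next_sibling_in_labels[OF that] assms by (metis labels.simps list.set_intros(2))
  thus ?thesis
    unfolding bad_vertices_def forest_bad_vertices_def bad_vertex_def
      initiates_sibling_descent_def initiates_sibling_ascent_def has_children_Node
    by blast
qed

lemma forest_bad_vertices_subset: "forest_bad_vertices f \<subseteq> set (forest_labels f)"
  using next_sibling_in_labels by (fastforce simp only: forest_bad_vertices_def)

text \<open>The sibling and child relations speak of labels. As labels are distinct, each label belongs to
  just one of \<open>a\<close>, \<open>us\<close> and \<open>ts\<close>, and the other two contribute neither a next sibling nor a
  child to it.\<close>
lemma forest_bad_vertices_Cons:
  assumes "distinct (forest_labels (Node a us # ts))"
  shows "forest_bad_vertices (Node a us # ts) =
     (if ts \<noteq> [] \<and> (label (hd ts) < a \<or> us \<noteq> []) then {a} else {}) \<union>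
     forest_bad_vertices us \<union> forest_bad_vertices ts"
proof (rule set_eqI)
  fix u :: nat
  let ?hc = "\<lambda>f. \<exists>c\<in>set f. has_children c u"
  have hc_in: "u \<in> set (forest_labels f)" if "?hc f" for f
    using that has_children_in_labels by fastforce
  have hc: "?hc (Node a us # ts) \<longleftrightarrow> (u = a \<and> us \<noteq> []) \<or> ?hc us \<or> ?hc ts"
    by (simp add: has_children_Node)
  have hd: "label (hd ts) \<noteq> a" if "ts \<noteq> []"
    using that assms label_in_labels[of "hd ts"] by (cases ts) auto
  have ns_in: "u \<in> set (forest_labels f)" if "next_sibling (Node 0 f) u v" for f v
    using next_sibling_in_labels[OF that] .
  consider "u = a" "u \<notin> set (forest_labels us)" "u \<notin> set (forest_labels ts)"
    | "u \<noteq> a" "u \<in> set (forest_labels us)" "u \<notin> set (forest_labels ts)"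
    | "u \<noteq> a" "u \<notin> set (forest_labels us)"
    using assms by auto
  thus "u \<in> forest_bad_vertices (Node a us # ts) \<longleftrightarrow>
    u \<in> (if ts \<noteq> [] \<and> (label (hd ts) < a \<or> us \<noteq> []) then {a} else {}) \<union>
     forest_bad_vertices us \<union> forest_bad_vertices ts"
  proof cases
    case 1
    hence "\<not> ?hc us" "\<not> ?hc ts" "\<And>v. \<not> next_sibling (Node 0 us) u v" "\<And>v. \<not> next_sibling (Node 0 ts) u v"
      using hc_in ns_in by blast+
    thus ?thesis using 1(1) hd unfolding forest_bad_vertices_def mem_Collect_eq hc next_sibling_Cons Un_iff
      by auto
  next
    case 2
    hence "\<not> ?hc ts" "\<And>v. \<not> next_sibling (Node 0 ts) u v"
      using hc_in ns_in by blast+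
    thus ?thesis using 2(1) unfolding forest_bad_vertices_def mem_Collect_eq hc next_sibling_Cons Un_iff
      by auto
  next
    case 3
    hence "\<not> ?hc us" "\<And>v. \<not> next_sibling (Node 0 us) u v"
      using hc_in ns_in by blast+
    thus ?thesis using 3(1) unfolding forest_bad_vertices_def mem_Collect_eq hc next_sibling_Cons Un_iff
      by auto
  qed
qed

lemma card_forest_bad_vertices:
  "distinct (forest_labels f) \<Longrightarrow> card (forest_bad_vertices f) = forest_bad f"
proof (induction f rule: forest_bad.induct)
  case 1
  show ?case using forest_bad_vertices_subset[of "[]"] by simp
next
  case (2 a us ts)
  note sub = forest_bad_vertices_subset[of us] forest_bad_vertices_subset[of ts]
  have fin: "finite (forest_bad_vertices us)" "finite (forest_bad_vertices ts)"
    using sub by (auto intro: finite_subset)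
  have d: "forest_bad_vertices us \<inter> forest_bad_vertices ts = {}"
    "a \<notin> forest_bad_vertices us" "a \<notin> forest_bad_vertices ts"
    using sub 2(3) by auto
  show ?case unfolding forest_bad_vertices_Cons[OF 2(3)]
    using 2 fin d by (auto simp: card_Un_disjoint)
qed

lemma card_bad_vertices:
  assumes "f \<in> increasing_forests n"
  shows "card (bad_vertices (Node 0 f)) = forest_bad f"
  using assms by (subst bad_vertices_Node) (auto simp: increasing_forests_def card_forest_bad_vertices)

section \<open>A differential equation for the closed form\<close>

unbundle fps_syntax

lemma fls_deriv_power_comm:
  fixes c :: "rat fls"
  shows "fls_deriv (c ^ n) = of_nat n * c ^ (n - 1) * fls_deriv c"
  by (subst fls_deriv_power) (simp_all add: mult.commute)

text \<open>The partial derivative with respect to \<open>y\<close>; \<^const>\<open>fps_deriv\<close> is the one with respect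
  to \<open>x\<close>.\<close>
definition coeff_deriv :: "rat fls fps \<Rightarrow> rat fls fps" where
  "coeff_deriv F = Abs_fps (\<lambda>n. fls_deriv (F $ n))"

lemma coeff_deriv_nth [simp]: "coeff_deriv F $ n = fls_deriv (F $ n)"
  by (simp add: coeff_deriv_def)

lemma coeff_deriv_mult: "coeff_deriv (F * G) = coeff_deriv F * G + F * coeff_deriv G"
  by (rule fps_ext)
     (simp add: fps_mult_nth fls_deriv_sum sum.distrib[symmetric] add.commute)

lemma coeff_deriv_diff: "coeff_deriv (F - G) = coeff_deriv F - coeff_deriv G"
  by (rule fps_ext) simp

lemma coeff_deriv_const: "coeff_deriv (fps_const c) = fps_const (fls_deriv c)"
  by (rule fps_ext) simp

lemma coeff_deriv_one [simp]: "coeff_deriv 1 = 0"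
  by (rule fps_ext) simp

lemma fls_deriv_divide_of_nat:
  fixes c :: "'a :: field_char_0 fls"
  assumes "d \<noteq> 0"
  shows "fls_deriv (c / of_nat d) = fls_deriv c / of_nat d"
proof -
  have d: "(of_nat d :: 'a fls) \<noteq> 0" using assms by simp
  have "fls_deriv (of_nat d * (c / of_nat d)) = of_nat d * fls_deriv (c / of_nat d)"
    by (subst fls_deriv_mult) simp
  hence "fls_deriv c = of_nat d * fls_deriv (c / of_nat d)" using d by simp
  thus ?thesis using d by (simp add: field_simps)
qed

lemma coeff_deriv_exp:
  "coeff_deriv (fps_exp c) = fps_const (fls_deriv c) * fps_X * fps_exp c"
proof (rule fps_ext)
  fix n
  show "coeff_deriv (fps_exp c) $ n = (fps_const (fls_deriv c) * fps_X * fps_exp c) $ n"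
  proof (cases n)
    case 0
    then show ?thesis by (simp add: mult.assoc)
  next
    case (Suc k)
    have "fls_deriv (c ^ Suc k / of_nat (fact (Suc k))) = fls_deriv (c ^ Suc k) / of_nat (fact (Suc k))"
      by (rule fls_deriv_divide_of_nat) simp
    also have "\<dots> = of_nat (Suc k) * (c ^ k * fls_deriv c) / (of_nat (Suc k) * of_nat (fact k))"
      by (simp only: fls_deriv_power_comm fact_Suc of_nat_mult diff_Suc_1 mult.assoc of_nat_id)
    also have "\<dots> = (c ^ k * fls_deriv c) / of_nat (fact k)"
      by (rule mult_divide_mult_cancel_left) (simp del: of_nat_Suc)
    also have "\<dots> = fls_deriv c * (c ^ k / of_nat (fact k))" by (simp add: mult.commute)
    finally show ?thesis by (simp add: Suc mult.assoc del: power_Suc fact_Suc)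
  qed
qed

abbreviation (input) "Y \<equiv> fps_const (fls_X :: rat fls)"

lemma closed_form_nth_0: "closed_form $ 0 = 1"
  by (simp add: closed_form_def)

lemma closed_form_squared:
  "closed_form ^ 2 * (Y * fps_exp (2 * (1 - fls_X)) - 1) = Y - 1"
  and denominator_nth_0: "(Y * fps_exp (2 * (1 - fls_X)) - 1) $ 0 \<noteq> 0"
proof -
  let ?E = "Y * fps_exp (2 * (1 - fls_X)) - 1" let ?R = "(Y - 1) / ?E"
  have X1: "(fls_X :: rat fls) \<noteq> 1"
    using fls_X_power_nth[of 1 1, where ?'a=rat] by (metis fls_one_nth fls_X_nth zero_neq_one)
  show u: "?E $ 0 \<noteq> 0" using X1 by simp
  have R: "?R * ?E = Y - 1" using u by (simp add: fps_divide_unit mult.assoc inverse_mult_eq_1)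
  have "?R $ 0 * ?E $ 0 = (Y - 1) $ 0" by (subst R[symmetric]) simp
  hence R0: "?R $ 0 = 1" using X1 by simp
  have "closed_form ^ 2 = ?R"
    using power_radical[of ?R "\<lambda>_ _. 1" 1] R0 unfolding closed_form_def by (simp add: numeral_2_eq_2)
  with R show "closed_form ^ 2 * ?E = Y - 1" by simp
qed

text \<open>Differentiating \<open>F\<^sup>2 (E - 1) = y - 1\<close> in each variable expresses \<open>F\<^sub>x\<close> and \<open>F\<^sub>y\<close> through \<open>F\<close> and
  \<open>E\<close>, because \<open>E\<^sub>x = 2(1 - y) E\<close> and \<open>y E\<^sub>y = (1 - 2xy) E\<close>. After multiplication by the nonzero factor
  \<open>2F(E - 1)\<close>, the terms in \<open>(1 - 2xy) E\<close> on the two sides of the equation agree, and what is left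
  is \<open>F\<^sup>2 (E - 1) = y - 1\<close> again.\<close>
lemma closed_form_pde:
  "(1 - 2 * fps_X * Y) * fps_deriv closed_form = Y * closed_form + 2 * Y * (1 - Y) * coeff_deriv closed_form"
proof -
  define E where "E = Y * fps_exp (2 * (1 - fls_X))"
  define F where "F = closed_form"
  let ?Fx = "fps_deriv F" and ?Fy = "coeff_deriv F"
  have eq: "F ^ 2 * (E - 1) = Y - 1" using closed_form_squared by (simp add: E_def F_def)
  have E1: "E - 1 \<noteq> 0" using denominator_nth_0 unfolding E_def by (metis fps_zero_nth)
  have F0: "F \<noteq> 0" using closed_form_nth_0 unfolding F_def by auto
  have c2: "fps_const (2 * (1 - fls_X)) = 2 * (1 - Y)"
    by (simp add: fps_const_mult[symmetric] fps_const_sub[symmetric] numeral_fps_const del: fps_const_mult fps_const_sub)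
  have N: "fps_const (- 2 :: rat fls) = - fps_const 2" by simp
  have Ex: "fps_deriv E = 2 * (1 - Y) * E" unfolding E_def fps_deriv_mult fps_exp_deriv c2 fps_deriv_const by (simp add: mult_ac)
  have "Y * coeff_deriv E = Y * (fps_exp (2 * (1 - fls_X)) - 2 * fps_X * E)"
    by (simp add: E_def coeff_deriv_mult coeff_deriv_const coeff_deriv_exp numeral_fps_const N algebra_simps
          del: fps_const_neg)
  also have "\<dots> = (1 - 2 * fps_X * Y) * E"
    by (simp add: E_def algebra_simps)
  finally have Ey: "Y * coeff_deriv E = (1 - 2 * fps_X * Y) * E" .
  from arg_cong[OF eq, of fps_deriv] have "2 * F * ?Fx * (E - 1) + F ^ 2 * fps_deriv E = 0"
    by (simp add: power2_eq_square algebra_simps)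
  hence X: "2 * F * ?Fx * (E - 1) = - (F ^ 2 * (2 * (1 - Y) * E))"
    unfolding Ex by (simp add: eq_neg_iff_add_eq_0)
  from arg_cong[OF eq, of coeff_deriv] have "2 * F * ?Fy * (E - 1) + F ^ 2 * coeff_deriv E = 1"
    by (simp add: power2_eq_square coeff_deriv_mult coeff_deriv_diff coeff_deriv_const algebra_simps)
  hence "2 * F * (Y * ?Fy) * (E - 1) + F ^ 2 * (Y * coeff_deriv E) = Y"
    by (metis (no_types, opaque_lifting) distrib_left mult.assoc mult.left_commute mult.right_neutral)
  hence Yd: "2 * F * (Y * ?Fy) * (E - 1) = Y - F ^ 2 * ((1 - 2 * fps_X * Y) * E)"
    unfolding Ey by (simp add: eq_diff_eq)
  have "(2 * F * (E - 1)) * ((1 - 2 * fps_X * Y) * ?Fx - Y * F - 2 * (1 - Y) * (Y * ?Fy))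
     = (1 - 2 * fps_X * Y) * (2 * F * ?Fx * (E - 1)) - 2 * Y * (F ^ 2 * (E - 1)) - 2 * (1 - Y) * (2 * F * (Y * ?Fy) * (E - 1))"
    by (simp add: power2_eq_square algebra_simps)
  also have "\<dots> = 0" unfolding X Yd eq by (simp add: algebra_simps)
  finally have "(1 - 2 * fps_X * Y) * ?Fx - Y * F - 2 * (1 - Y) * (Y * ?Fy) = 0"
    using E1 F0 by simp
  thus ?thesis unfolding F_def by (simp add: algebra_simps)
qed

lemma closed_form_recurrence:
  "of_nat (Suc n) * closed_form $ Suc n =
     of_nat (2 * n + 1) * fls_X * closed_form $ n + 2 * fls_X * (1 - fls_X) * fls_deriv (closed_form $ n)"
proof -
  have *: "fps_deriv closed_form = fps_X * (fps_const (2 * fls_X) * fps_deriv closed_form) +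
     fps_const fls_X * closed_form + fps_const (2 * fls_X * (1 - fls_X)) * coeff_deriv closed_form"
    using closed_form_pde
    by (simp add: fps_const_mult[symmetric] fps_const_sub[symmetric] numeral_fps_const algebra_simps del: fps_const_mult fps_const_sub)
  show ?thesis
    using arg_cong[OF *, of "\<lambda>F. F $ n"] by (cases n) (simp_all add: algebra_simps)
qed

section \<open>Comparison of coefficients\<close>

lemma sum_bad_recurrence:
  fixes y :: "'a :: comm_ring_1"
  assumes "n \<ge> 1"
  shows "(\<Sum>g\<in>increasing_forests (Suc n). y ^ (forest_bad g + 1)) =
    (\<Sum>f\<in>increasing_forests n. y ^ (forest_bad f + 1) *
       (of_nat (2 * (forest_bad f + 1)) + (of_nat (2 * n + 1) - of_nat (2 * (forest_bad f + 1))) * y))"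
proof -
  have "(\<Sum>g\<leftarrow>leaf_insertions (Suc n) f. y ^ (forest_bad g + 1)) = y ^ (forest_bad f + 1) *
       (of_nat (2 * (forest_bad f + 1)) + (of_nat (2 * n + 1) - of_nat (2 * (forest_bad f + 1))) * y)"
    if f: "f \<in> increasing_forests n" for f
  proof -
    have s: "set (forest_labels f) = {1..n}" and d: "distinct (forest_labels f)"
      using f by (auto simp: increasing_forests_def)
    have len: "length (forest_labels f) = n"
      using s distinct_card[OF d] by simp
    have "f \<noteq> []" using len assms by auto
    have "(\<Sum>g\<leftarrow>leaf_insertions (Suc n) f. y ^ (forest_bad g + 1)) =
       y * (\<Sum>g\<leftarrow>leaf_insertions (Suc n) f. y ^ forest_bad g)"
      by (simp add: sum_list_const_mult)
    also have "(\<Sum>g\<leftarrow>leaf_insertions (Suc n) f. y ^ forest_bad g) =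
       y ^ forest_bad f * (of_nat (2 * forest_bad f + 2) +
       (of_nat (2 * n) - of_nat (2 * forest_bad f + 1)) * y)"
    proof -
      have "\<forall>l\<in>set (forest_labels f). l < Suc n" unfolding s by auto
      from sum_leaf_insertions[OF this \<open>f \<noteq> []\<close>, of y] show ?thesis unfolding len .
    qed
    finally show ?thesis by (simp add: algebra_simps)
  qed
  thus ?thesis unfolding sum_increasing_forests_Suc by (intro sum.cong) auto
qed

text \<open>The case \<open>n = 0\<close> has to be left out: the closed form has constant term \<open>1\<close>, but the empty
  forest would contribute \<open>y\<close>. Hence the induction starts at \<open>n = 1\<close>.\<close>
lemma closed_form_nth:
  assumes "n \<ge> 1"
  shows "fact n * closed_form $ n = (\<Sum>f\<in>increasing_forests n. fls_X ^ (forest_bad f + 1))"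
  using assms
proof (induction n rule: nat_induct_at_least)
  case base
  have "closed_form $ 1 = fls_X"
    using closed_form_recurrence[of 0] by (simp add: closed_form_nth_0)
  moreover have "increasing_forests 1 = {[Node 1 []]}"
    using increasing_forests_Suc[of 0] by (simp add: increasing_forests_0 leaf_insertions_def)
  ultimately show ?case by simp
next
  case (Suc n)
  define P :: "rat fls" where "P = (\<Sum>f\<in>increasing_forests n. fls_X ^ (forest_bad f + 1))"
  have "fact (Suc n) * closed_form $ Suc n = fact n * (of_nat (Suc n) * closed_form $ Suc n)"
    by (simp add: algebra_simps)
  also have "\<dots> = of_nat (2 * n + 1) * fls_X * (fact n * closed_form $ n) +
      2 * fls_X * (1 - fls_X) * (fact n * fls_deriv (closed_form $ n))"
    unfolding closed_form_recurrence by (simp add: algebra_simps)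
  also have "fact n * fls_deriv (closed_form $ n) = fls_deriv (fact n * closed_form $ n)"
    using fls_deriv_of_nat[of "fact n", where ?'a=rat] by (subst fls_deriv_mult) simp
  also have "fact n * closed_form $ n = P" using Suc by (simp add: P_def)
  also have "of_nat (2 * n + 1) * fls_X * P + 2 * fls_X * (1 - fls_X) * fls_deriv P =
     (\<Sum>f\<in>increasing_forests n. of_nat (2 * n + 1) * fls_X * fls_X ^ (forest_bad f + 1) +
        2 * fls_X * (1 - fls_X) * (of_nat (forest_bad f + 1) * fls_X ^ forest_bad f))"
    by (simp only: P_def sum_distrib_left sum.distrib fls_deriv_sum fls_deriv_power_comm fls_deriv_X
          mult_1_right add_diff_cancel_right')
  also have "\<dots> = (\<Sum>f\<in>increasing_forests n. fls_X ^ (forest_bad f + 1) *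
       (of_nat (2 * (forest_bad f + 1)) + (of_nat (2 * n + 1) - of_nat (2 * (forest_bad f + 1))) * fls_X))"
    by (intro sum.cong refl) (simp add: algebra_simps)
  also have "\<dots> = (\<Sum>g\<in>increasing_forests (Suc n). fls_X ^ (forest_bad g + 1))"
    by (rule sum_bad_recurrence[OF Suc.hyps, symmetric])
  finally show ?case .
qed

definition trees_with_bad :: "nat \<Rightarrow> nat \<Rightarrow> nat plane_tree set" where
  "trees_with_bad n l = {t \<in> increasing_ordered_trees n. card (bad_vertices t) = l - 1}"

lemma card_trees_with_bad:
  "card (trees_with_bad n l) = card {f \<in> increasing_forests n. forest_bad f = l - 1}"
proof -
  have "trees_with_bad n l = Node 0 ` {f \<in> increasing_forests n. forest_bad f = l - 1}"
    unfolding trees_with_bad_def increasing_ordered_trees_eq using card_bad_vertices by auto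
  thus ?thesis by (simp add: card_image inj_on_def)
qed

lemma sum_power_eq_counts:
  "(\<Sum>f\<in>increasing_forests n. (fls_X :: rat fls) ^ (forest_bad f + 1)) =
     fps_to_fls (Abs_fps (\<lambda>l. if l = 0 then 0 else of_nat (card (trees_with_bad n l))))"
proof (rule fls_eqI)
  fix k :: int
  have "(\<Sum>f\<in>increasing_forests n. (fls_X :: rat fls) ^ (forest_bad f + 1)) $$ k =
     (\<Sum>f\<in>increasing_forests n. of_bool (k = int (forest_bad f + 1)))"
    unfolding fls_nth_sum fls_X_power_nth by (intro sum.cong) auto
  also have "\<dots> = of_nat (card {f \<in> increasing_forests n. k = int (forest_bad f + 1)})"
    by (simp add: finite_increasing_forests Int_def)
  also have "{f \<in> increasing_forests n. k = int (forest_bad f + 1)} =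
     (if k \<le> 0 then {} else {f \<in> increasing_forests n. forest_bad f = nat k - 1})"
    by auto
  finally show "(\<Sum>f\<in>increasing_forests n. (fls_X :: rat fls) ^ (forest_bad f + 1)) $$ k =
     fps_to_fls (Abs_fps (\<lambda>l. if l = 0 then 0 else of_nat (card (trees_with_bad n l)))) $$ k"
    by (auto simp: card_trees_with_bad)
qed

lemma closed_form_eq: "closed_form = 1 + double_series (\<lambda>n l. of_nat (card (trees_with_bad n l)))"
proof (rule fps_ext)
  fix n
  show "closed_form $ n = (1 + double_series (\<lambda>n l. of_nat (card (trees_with_bad n l)))) $ n"
  proof (cases "n = 0")
    case True
    thus ?thesis by (simp add: double_series_def closed_form_nth_0)
  next
    case False
    have *: "fps_to_fls (Abs_fps (\<lambda>l. if l = 0 then 0 else of_nat (card (trees_with_bad n l)))) =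
      fact n * fps_to_fls (Abs_fps (\<lambda>l. if l = 0 then 0 else rat_of_nat (card (trees_with_bad n l)) / fact n))"
    proof (rule fls_eqI)
      fix k
      have f: "(fact n :: rat fls) = fls_const (fact n)" by (metis fls_of_nat of_nat_fact)
      show "fps_to_fls (Abs_fps (\<lambda>l. if l = 0 then 0 else of_nat (card (trees_with_bad n l)))) $$ k =
      (fact n * fps_to_fls (Abs_fps (\<lambda>l. if l = 0 then 0 else rat_of_nat (card (trees_with_bad n l)) / fact n))) $$ k"
        unfolding f by simp
    qed
    have "fact n * closed_form $ n = fact n * double_series (\<lambda>n l. of_nat (card (trees_with_bad n l))) $ n"
      using False closed_form_nth[of n] unfolding sum_power_eq_counts * by (simp add: double_series_def)
    thus ?thesis using False by simp
  qed
qed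

lemma double_series_inject:
  assumes "double_series a = double_series b" "n \<ge> 1" "l \<ge> 1"
  shows "a n l = b n l"
proof -
  have "fls_nth (double_series a $ n) (int l) = fls_nth (double_series b $ n) (int l)"
    using assms by simp
  thus ?thesis using assms by (simp add: double_series_def)
qed

theorem theorem2:
  shows "(\<exists>a. closed_form = 1 + double_series a) \<and>
    (\<forall>a. closed_form = 1 + double_series a \<longrightarrow>
      (\<forall>n\<ge>1. \<forall>l\<ge>1. a n l =
        of_nat (card {t \<in> increasing_ordered_trees n. card (bad_vertices t) = l - 1})))"
proof (intro conjI allI impI)
  show "\<exists>a. closed_form = 1 + double_series a" using closed_form_eq by blast
next
  fix a n l
  assume a: "closed_form = 1 + double_series a" and "n \<ge> (1::nat)" "l \<ge> (1::nat)"
  have "double_series a = double_series (\<lambda>n l. of_nat (card (trees_with_bad n l)))"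
    using a closed_form_eq by (metis add_left_cancel)
  from double_series_inject[OF this \<open>n \<ge> 1\<close> \<open>l \<ge> 1\<close>]
  show "a n l = of_nat (card {t \<in> increasing_ordered_trees n. card (bad_vertices t) = l - 1})"
    by (simp add: trees_with_bad_def)
qed

end
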